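(* Let $\Phi_K=\{\phi(W^{(1)}),\dots,\phi(W^{(K)})\}$ be the set of $K$ disturbance samples mapped through $\phi(W):=G_wW$, and let $\Psi_{\hat K}=\{\psi^{(1)},\dots,\psi^{(\hat K)}\}\subset\mathbb{R}^{Nn_x}$ be a set of selected seeds. For $j\in\{1,\dots,\hat K\}$ let $V^{(j)}=V^{(j)}_{\Phi_K}(\Psi_{\hat K})$ be the $j$-th Voronoi cell of $\Phi_K$ with respect to $\Psi_{\hat K}$, let $\alpha^{(j)}=|V^{(j)}|$ be its number of elements, and let $\varepsilon^{(j)}=[\epsilon^{(j)}_1,\dots,\epsilon^{(j)}_L]^\top$ with $$\epsilon^{(j)}_\ell=\max_{\phi\in V^{(j)}}\left(F_\ell\phi-F_\ell\psi^{(j)}\right),\qquad \ell\in\{1,\dots,L\},$$ where $F_\ell$ is the $\ell$-th row of $F$. Then the partition-based problem (with these $\psi^{(j)},\alpha^{(j)},\varepsilon^{(j)}$) provides a lower bound for the sampled problem, i.e. their optimal values satisfy $$p^\ast_{\hat K}(x_0)\le p^\ast_K(x_0).$$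
   Context: System. Consider $x_{t+1}=Ax_t+Bu_t+w_t$ with $x_t\in\mathbb{R}^{n_x}$, $u_t\in\mathcal{U}\subseteq\mathbb{R}^{n_u}$, $w_t\in\mathcal{W}\subseteq\mathbb{R}^{n_x}$. Over a horizon $N\ge1$, with $X=[x_1^\top,\dots,x_N^\top]^\top$, $U=[u_0^\top,\dots,u_{N-1}^\top]^\top\in\mathcal{U}^N$, $W=[w_0^\top,\dots,w_{N-1}^\top]^\top\in\mathcal{W}^N$, one has $X=G_xx_0+G_uU+G_wW$, where the $t$-th block row reads $x_t=A^tx_0+\sum_{s=0}^{t-1}A^{t-1-s}(Bu_s+w_s)$. The safe set $\mathcal{S}$ and target set $\mathcal{T}$ are polytopes in $\mathbb{R}^{n_x}$, and $\mathcal{R}=\mathcal{S}^{N-1}\times\mathcal{T}=\{X\in\mathbb{R}^{Nn_x}:FX\le h\}$ with $F\in\mathbb{R}^{L\times Nn_x}$, $h\in\mathbb{R}^L$ (componentwise inequalities). The initial state $x_0\in\mathcal{S}$ and the disturbance samples $W^{(1)},\dots,W^{(K)}\in\mathcal{W}^N$ are given. Sampled problem. Maximize $\frac1K\sum_{i=1}^K z^{(i)}$ over $U\in\mathcal{U}^N$ and $z^{(i)}\in\{0,1\}$ subject to $X^{(i)}=G_xx_0+G_uU+G_wW^{(i)}$ and $FX^{(i)}\le h+M(1-z^{(i)})\mathbf{1}$, $i=1,\dots,K$. Optimal value: $p_K^\ast(x_0)$. Partition-based problem. Maximize $\frac1K\sum_{j=1}^{\hat K}\alpha^{(j)}\hat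 z^{(j)}$ over $U\in\mathcal{U}^N$ and $\hat z^{(j)}\in\{0,1\}$ subject to $\hat X^{(j)}=G_xx_0+G_uU+\psi^{(j)}$ and $F\hat X^{(j)}\le h-\varepsilon^{(j)}+M(1-\hat z^{(j)})\mathbf{1}$, $j=1,\dots,\hat K$. Optimal value: $p_{\hat K}^\ast(x_0)$. $M>0$ is the same large constant in both problems, large enough that the constraints are inactive whenever the corresponding binary variable equals $0$ (big-M convention). Voronoi cells. $V^{(j)}_{\Phi_K}(\Psi_{\hat K})=\{p\in\Phi_K:\ \|p-\psi^{(j)}\|\le\|p-\psi^{(\ell)}\|\ \text{for all }\ell\ne j\}$ (Euclidean norm). The cells partition the $K$ samples: each sample (counted with its index $i$) is assigned to exactly one cell, ties being broken arbitrarily. All cells are nonempty, so $\alpha^{(j)}\in\{1,\dots,K\}$ and $\sum_{j=1}^{\hat K}\alpha^{(j)}=K$. *)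

theory Defs
  imports "HOL-Analysis.Analysis"
begin

text \<open>
  The horizon is a finite linearly ordered index type \<open>'t\<close> with \<open>N = CARD('t)\<close> elements, so
  stacked vectors of \<open>N\<close> blocks of dimension \<open>CARD('n)\<close> live in the Euclidean space
  \<open>real ^ ('t \<times> 'n)\<close>. The element \<open>t\<close> with exactly \<open>k\<close> predecessors indexes the blocks
  \<open>u\<^sub>k\<close> and \<open>w\<^sub>k\<close> of \<open>U\<close> and \<open>W\<close>, and the block \<open>x\<^sub>k\<^sub>+\<^sub>1\<close> of \<open>X\<close>.
\<close>

definition pos :: "'t::{finite,linorder} \<Rightarrow> nat" where
  "pos t = card {..<t}"

definition block :: "'a ^ ('t::finite \<times> 'n::finite) \<Rightarrow> 't \<Rightarrow> 'a ^ 'n" where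
  "block X t = (\<chi> i. X $ (t, i))"

definition cart_power :: "('a ^ 'n::finite) set \<Rightarrow> ('a ^ ('t::finite \<times> 'n)) set" where
  "cart_power C = {X. \<forall>t. block X t \<in> C}"

text \<open>
  \<open>A ^ k\<close> would be the entrywise power.
\<close>

primrec matpow :: "real ^ 'n ^ 'n \<Rightarrow> nat \<Rightarrow> real ^ 'n ^ 'n" where
  "matpow A 0 = mat 1"
| "matpow A (Suc k) = A ** matpow A k"

definition G_x :: "real ^ 'n ^ 'n \<Rightarrow> real ^ 'n ^ ('t::{finite,linorder} \<times> 'n::finite)" where
  "G_x A = (\<chi> p. matpow A (pos (fst p) + 1) $ snd p)"

definition G_u :: "real ^ 'n ^ 'n \<Rightarrow> real ^ 'm ^ 'n
    \<Rightarrow> real ^ ('t \<times> 'm::finite) ^ ('t::{finite,linorder} \<times> 'n::finite)" where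
  "G_u A B = (\<chi> p q. if fst q \<le> fst p
     then (matpow A (pos (fst p) - pos (fst q)) ** B) $ snd p $ snd q else 0)"

definition G_w :: "real ^ 'n ^ 'n \<Rightarrow> real ^ ('t \<times> 'n) ^ ('t::{finite,linorder} \<times> 'n::finite)" where
  "G_w A = (\<chi> p q. if fst q \<le> fst p
     then matpow A (pos (fst p) - pos (fst q)) $ snd p $ snd q else 0)"

text \<open>
  The stacked state with the disturbance contribution \<open>d\<close> given directly in
  \<open>real ^ ('t \<times> 'n)\<close>: \<open>d = G_w A *v W\<close> for a sample, \<open>d = \<psi>\<close> for a seed.
\<close>

definition stacked_state :: "real ^ 'n ^ 'n \<Rightarrow> real ^ 'm ^ 'n \<Rightarrow> real ^ 'n
    \<Rightarrow> real ^ ('t \<times> 'm::finite) \<Rightarrow> real ^ ('t \<times> 'n) \<Rightarrow> real ^ ('t::{finite,linorder} \<times> 'n::finite)" where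
  "stacked_state A B x0 U d = G_x A *v x0 + G_u A B *v U + d"

definition reach_avoid_set :: "(real ^ 'n) set \<Rightarrow> (real ^ 'n) set
    \<Rightarrow> (real ^ ('t::{finite,linorder} \<times> 'n::finite)) set" where
  "reach_avoid_set S T =
     {X. (\<forall>t. t \<noteq> Max UNIV \<longrightarrow> block X t \<in> S) \<and> block X (Max UNIV) \<in> T}"

text \<open>
  Optimal values are suprema in \<^typ>\<open>ereal\<close>. Both objectives take finitely many values, so the
  supremum is a maximum whenever the problem is feasible; otherwise it is \<open>-\<infinity>\<close>.
\<close>

definition sampled_feasible where
  "sampled_feasible A B x0 (\<U> :: (real ^ 'm) set)
      (F :: real ^ ('t::{finite,linorder} \<times> 'n::finite) ^ 'l) h M (K::nat) W =
     {(U, z). U \<in> cart_power \<U> \<and> (\<forall>i\<in>{1..K}. z i \<in> {0, 1} \<and>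
        F *v stacked_state A B x0 U (G_w A *v W i) \<le> h + vec (M * (1 - z i)))}"

definition sampled_value where
  "sampled_value A B x0 (\<U> :: (real ^ 'm) set)
      (F :: real ^ ('t::{finite,linorder} \<times> 'n::finite) ^ 'l) h M (K::nat) W =
     (SUP (U, z) \<in> sampled_feasible A B x0 \<U> F h M K W.
        ereal (1 / real K * (\<Sum>i = 1..K. z i)))"

definition partition_feasible where
  "partition_feasible A B x0 (\<U> :: (real ^ 'm) set)
      (F :: real ^ ('t::{finite,linorder} \<times> 'n::finite) ^ 'l) h M (Kh::nat) \<psi> \<epsilon> =
     {(U, z). U \<in> cart_power \<U> \<and> (\<forall>j\<in>{1..Kh}. z j \<in> {0, 1} \<and>
        F *v stacked_state A B x0 U (\<psi> j) \<le> h - \<epsilon> j + vec (M * (1 - z j)))}"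

definition partition_value where
  "partition_value A B x0 (\<U> :: (real ^ 'm) set)
      (F :: real ^ ('t::{finite,linorder} \<times> 'n::finite) ^ 'l) h M (K::nat) (Kh::nat) \<psi> (\<alpha> :: nat \<Rightarrow> nat) \<epsilon> =
     (SUP (U, z) \<in> partition_feasible A B x0 \<U> F h M Kh \<psi> \<epsilon>.
        ereal (1 / real K * (\<Sum>j = 1..Kh. real (\<alpha> j) * z j)))"

text \<open>
  The big-M convention: in either problem the constraint with binary variable \<open>0\<close> holds for
  every admissible input.
\<close>

definition big_M where
  "big_M A B x0 (\<U> :: (real ^ 'm) set)
      (F :: real ^ ('t::{finite,linorder} \<times> 'n::finite) ^ 'l) h (K::nat) W (Kh::nat) \<psi> \<epsilon> M \<longleftrightarrow> 0 < M \<and>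
     (\<forall>U \<in> cart_power \<U>.
        (\<forall>i\<in>{1..K}. F *v stacked_state A B x0 U (G_w A *v W i) \<le> h + vec M) \<and>
        (\<forall>j\<in>{1..Kh}. F *v stacked_state A B x0 U (\<psi> j) \<le> h - \<epsilon> j + vec M))"

definition voronoi_cell :: "'a::real_normed_vector set \<Rightarrow> nat \<Rightarrow> (nat \<Rightarrow> 'a) \<Rightarrow> nat \<Rightarrow> 'a set" where
  "voronoi_cell \<Phi> Kh \<psi> j =
     {p \<in> \<Phi>. \<forall>l\<in>{1..Kh}. l \<noteq> j \<longrightarrow> norm (p - \<psi> j) \<le> norm (p - \<psi> l)}"

text \<open>
  Samples are counted with their index, so a cell is represented by the set \<open>V j\<close> of the sample
  indices assigned to seed \<open>j\<close>. Any resolution of ties is admitted.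
\<close>

definition voronoi_partition ::
    "nat \<Rightarrow> (nat \<Rightarrow> 'a::real_normed_vector) \<Rightarrow> nat \<Rightarrow> (nat \<Rightarrow> 'a) \<Rightarrow> (nat \<Rightarrow> nat set) \<Rightarrow> bool" where
  "voronoi_partition K \<phi> Kh \<psi> V \<longleftrightarrow>
     (\<forall>j\<in>{1..Kh}. V j \<noteq> {} \<and> \<phi> ` V j \<subseteq> voronoi_cell (\<phi> ` {1..K}) Kh \<psi> j) \<and>
     disjoint_family_on V {1..Kh} \<and> (\<Union>j\<in>{1..Kh}. V j) = {1..K}"

definition cell_margin ::
    "real ^ 'p ^ 'l \<Rightarrow> (nat \<Rightarrow> real ^ 'p) \<Rightarrow> (nat \<Rightarrow> real ^ 'p) \<Rightarrow> (nat \<Rightarrow> nat set) \<Rightarrow> nat \<Rightarrow> real ^ 'l" where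
  "cell_margin F \<phi> \<psi> V j = (\<chi> l. MAX p \<in> \<phi> ` V j. F $ l \<bullet> p - F $ l \<bullet> \<psi> j)"

text \<open>
  The block rows of the stacked dynamics.
\<close>

lemma block_stacked_state:
  fixes A :: "real ^ 'n ^ 'n" and B :: "real ^ 'm ^ 'n"
    and U :: "real ^ ('t::{finite,linorder} \<times> 'm)"
  shows "block (stacked_state A B x0 U (G_w A *v W)) t =
    matpow A (pos t + 1) *v x0 + (\<Sum>s\<le>t. matpow A (pos t - pos s) *v (B *v block U s + block W s))"
proof -
  have x: "block (G_x A *v x0) t = matpow A (pos t + 1) *v x0"
    by (simp add: vec_eq_iff block_def G_x_def matrix_vector_mult_def)
  have low: "(\<Sum>q\<in>UNIV. (if fst q \<le> t then f q else 0)) = (\<Sum>s\<le>t. \<Sum>j\<in>UNIV. f (s, j))"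
    for f :: "'t \<times> 'k::finite \<Rightarrow> real"
  proof -
    have "{q. fst q \<le> t} = {..t} \<times> (UNIV :: 'k set)" by auto
    then show ?thesis by (simp add: sum.If_cases sum.cartesian_product)
  qed
  have u: "block (G_u A B *v U) t = (\<Sum>s\<le>t. (matpow A (pos t - pos s) ** B) *v block U s)"
    unfolding vec_eq_iff block_def G_u_def matrix_vector_mult_def
    by (simp add: if_distribR if_distrib[of "\<lambda>x. x * _"] low cong: if_cong)
  have w: "block (G_w A *v W) t = (\<Sum>s\<le>t. matpow A (pos t - pos s) *v block W s)"
    unfolding vec_eq_iff block_def G_w_def matrix_vector_mult_def
    by (simp add: if_distribR if_distrib[of "\<lambda>x. x * _"] low cong: if_cong)
  have "block (stacked_state A B x0 U (G_w A *v W)) t =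
      block (G_x A *v x0) t + block (G_u A B *v U) t + block (G_w A *v W) t"
    by (simp add: stacked_state_def block_def vec_eq_iff)
  then show ?thesis
    by (simp add: x u w matrix_vector_right_distrib sum.distrib matrix_vector_mul_assoc)
qed

end

theory Submission
  imports Defs
begin

text \<open>
  Keep the input \<open>U\<close> and give every sample the binary value of the cell it belongs to. The
  margin \<open>\<epsilon>\<^sup>j\<close> dominates \<open>F (\<phi> - \<psi>\<^sup>j)\<close> on the \<open>j\<close>-th cell, so the
  tightened constraint at the seed implies the constraint at each sample of the cell, whichever
  the binary value. Summing over the cells, the two objectives coincide.
\<close>

lemma stacked_state_shift:
  "stacked_state A B x0 U d = stacked_state A B x0 U d' + (d - d')"
  by (simp add: stacked_state_def)

text \<open>In each row, the sample \<open>i\<close> contributes one of the values whose maximum is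
  the margin; finiteness of \<open>V j\<close> makes \<open>Max\<close> an upper bound for
  it.\<close>

lemma cell_margin_upper:
  assumes "finite (V j)" and "i \<in> V j"
  shows "F *v (\<phi> i - \<psi> j) \<le> cell_margin F \<phi> \<psi> V j"
  using assms
  by (auto simp: less_eq_vec_def cell_margin_def matrix_vector_mul_component inner_diff_right
      intro!: Max_ge)

text \<open>Regrouping by disjoint cells makes the summand constant on each cell, so a cell
  contributes its size times the value at its seed. This matches the two objectives.\<close>

lemma sum_cell_values:
  fixes z :: "nat \<Rightarrow> real"
  assumes "finite J" and "\<And>j. j \<in> J \<Longrightarrow> finite (V j)" and "disjoint_family_on V J"
    and "\<And>i j. j \<in> J \<Longrightarrow> i \<in> V j \<Longrightarrow> c i = j"
  shows "(\<Sum>i\<in>(\<Union>j\<in>J. V j). z (c i)) = (\<Sum>j\<in>J. real (card (V j)) * z j)"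
proof -
  have "(\<Sum>i\<in>(\<Union>j\<in>J. V j). z (c i)) = (\<Sum>j\<in>J. \<Sum>i\<in>V j. z (c i))"
    using assms(1-3) by (intro sum.UNION_disjoint) (auto simp: disjoint_family_on_def)
  also have "\<dots> = (\<Sum>j\<in>J. \<Sum>i\<in>V j. z j)"
    using assms(4) by (intro sum.cong) auto
  finally show ?thesis by simp
qed

text \<open>Covering makes the assignment of samples to seeds total, and disjointness makes it
  single-valued.\<close>

lemma voronoi_partition_index:
  assumes "voronoi_partition K \<phi> Kh \<psi> V"
  obtains c where "\<And>i. i \<in> {1..K} \<Longrightarrow> c i \<in> {1..Kh} \<and> i \<in> V (c i)"
    and "\<And>i j. j \<in> {1..Kh} \<Longrightarrow> i \<in> V j \<Longrightarrow> c i = j"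
proof -
  have cover: "(\<Union>j\<in>{1..Kh}. V j) = {1..K}" and disj: "disjoint_family_on V {1..Kh}"
    using assms by (auto simp: voronoi_partition_def)
  have "\<forall>i\<in>{1..K}. \<exists>j. j \<in> {1..Kh} \<and> i \<in> V j"
    unfolding cover[symmetric] by blast
  then obtain c where c: "\<And>i. i \<in> {1..K} \<Longrightarrow> c i \<in> {1..Kh} \<and> i \<in> V (c i)"
    by metis
  have "c i = j" if "j \<in> {1..Kh}" "i \<in> V j" for i j
  proof (rule ccontr)
    assume "c i \<noteq> j"
    \<comment> \<open>The choice of \<open>c\<close> is specified only on \<open>{1..K}\<close>, so
      \<open>i\<close> must first be placed there.\<close>
    moreover have "i \<in> {1..K}" unfolding cover[symmetric] using that by blast
    ultimately show False
      using c[of i] that disjoint_family_onD[OF disj, of "c i" j] by blast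
  qed
  with c that show ?thesis by blast
qed

theorem theorem2:
  fixes A :: "real ^ 'n ^ 'n" and B :: "real ^ 'm ^ 'n"
    and \<U> :: "(real ^ 'm) set" and \<W> S T :: "(real ^ 'n) set"
    and F :: "real ^ ('t::{finite,linorder} \<times> 'n) ^ 'l" and h :: "real ^ 'l"
    and x0 :: "real ^ 'n" and M :: real and K Kh :: nat
    and W \<phi> \<psi> :: "nat \<Rightarrow> real ^ ('t \<times> 'n)"
    and V :: "nat \<Rightarrow> nat set" and \<alpha> :: "nat \<Rightarrow> nat" and \<epsilon> :: "nat \<Rightarrow> real ^ 'l"
  assumes "polytope S" and "polytope T"
    and "reach_avoid_set S T = {X. F *v X \<le> h}"
    and "x0 \<in> S"
    and "1 \<le> K" and "\<forall>i\<in>{1..K}. W i \<in> cart_power \<W>"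
    and "\<forall>i\<in>{1..K}. \<phi> i = G_w A *v W i"
    and "voronoi_partition K \<phi> Kh \<psi> V"
    and "\<forall>j\<in>{1..Kh}. \<alpha> j = card (V j)"
    and "\<forall>j\<in>{1..Kh}. \<epsilon> j = cell_margin F \<phi> \<psi> V j"
    and "big_M A B x0 \<U> F h K W Kh \<psi> \<epsilon> M"
  shows "partition_value A B x0 \<U> F h M K Kh \<psi> \<alpha> \<epsilon> \<le> sampled_value A B x0 \<U> F h M K W"
proof -
  obtain c where c: "\<And>i. i \<in> {1..K} \<Longrightarrow> c i \<in> {1..Kh} \<and> i \<in> V (c i)"
    and uniq: "\<And>i j. j \<in> {1..Kh} \<Longrightarrow> i \<in> V j \<Longrightarrow> c i = j"
    using voronoi_partition_index[OF assms(8)] by blast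
  have cover: "(\<Union>j\<in>{1..Kh}. V j) = {1..K}" and disj: "disjoint_family_on V {1..Kh}"
    using assms(8) by (auto simp: voronoi_partition_def)
  have fin: "finite (V j)" if "j \<in> {1..Kh}" for j
    using that cover by (metis UN_upper finite_atLeastAtMost finite_subset)
  have feasible: "(U, z \<circ> c) \<in> sampled_feasible A B x0 \<U> F h M K W"
    if Uz: "(U, z) \<in> partition_feasible A B x0 \<U> F h M Kh \<psi> \<epsilon>" for U z
  proof -
    have "F *v stacked_state A B x0 U (G_w A *v W i) \<le> h + vec (M * (1 - z (c i)))"
      if i: "i \<in> {1..K}" for i
    proof -
      \<comment> \<open>The state depends on the disturbance contribution by pure translation, so
        moving from seed to sample adds only \<open>F *v (\<phi> i - \<psi> (c i))\<close>.\<close>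
      have "F *v stacked_state A B x0 U (G_w A *v W i)
          = F *v stacked_state A B x0 U (\<psi> (c i)) + F *v (\<phi> i - \<psi> (c i))"
        using assms(7) i stacked_state_shift[of A B x0 U "\<phi> i" "\<psi> (c i)"]
        by (simp add: matrix_vector_right_distrib)
      \<comment> \<open>The margin cancels the tightening exactly; the big-M term is carried along
        unchanged, so no case split on the binary value arises.\<close>
      also have "\<dots> \<le> (h - \<epsilon> (c i) + vec (M * (1 - z (c i)))) + \<epsilon> (c i)"
        using c[OF i] Uz assms(10) cell_margin_upper[where F = F and V = V and \<phi> = \<phi> and \<psi> = \<psi>, OF fin[of "c i"], of i]
        by (intro add_mono) (auto simp: partition_feasible_def)
      finally show ?thesis by simp
    qed
    \<comment> \<open>Binary values of \<open>z\<close> are guaranteed only on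
      \<open>{1..Kh}\<close>, which contains every \<open>c i\<close>.\<close>
    then show ?thesis
      using Uz c by (auto simp: partition_feasible_def sampled_feasible_def)
  qed
  have objective: "(\<Sum>j = 1..Kh. real (\<alpha> j) * z j) = (\<Sum>i = 1..K. (z \<circ> c) i)" for z :: "nat \<Rightarrow> real"
    using sum_cell_values[where z = z and V = V and c = c, OF _ fin disj uniq] assms(9) unfolding cover by simp
  show ?thesis
    unfolding partition_value_def sampled_value_def
  \<comment> \<open>An infeasible partition problem is covered too: its supremum is the bottom
    element of \<open>ereal\<close>.\<close>
  proof (rule SUP_mono)
    fix Uz assume "Uz \<in> partition_feasible A B x0 \<U> F h M Kh \<psi> \<epsilon>"
    then show "\<exists>Uz'\<in>sampled_feasible A B x0 \<U> F h M K W.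
        (case Uz of (U, z) \<Rightarrow> ereal (1 / real K * (\<Sum>j = 1..Kh. real (\<alpha> j) * z j)))
        \<le> (case Uz' of (U, z) \<Rightarrow> ereal (1 / real K * (\<Sum>i = 1..K. z i)))"
      using feasible[of "fst Uz" "snd Uz"] objective[of "snd Uz"]
      by (intro bexI[of _ "(fst Uz, snd Uz \<circ> c)"]) (auto simp: case_prod_beta)
  qed
qed

end
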